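(* Let $b, c$ be given integers and consider the diophantine equation $x^2 + bx + c = y^2$. 1. Assume $b^2 - 4c \neq 0$. Then this equation has an even number of solution pairs in $\mathbb{Z}\times\mathbb{Z}$, and: (i) If $b$ is an odd integer, then all the solutions of the equation are given by $$x = \frac{-2b \pm (\delta_1 + \delta_2)}{4}, \qquad y = \frac{\delta_1 - \delta_2}{4},$$ where $\delta_1, \delta_2$ can be any integers such that $\delta_1\delta_2 = b^2 - 4c$, $\delta_1 + \delta_2 > 0$, and with either $\delta_1 \equiv \delta_2 \equiv 1 \pmod 4$ or $\delta_1 \equiv \delta_2 \equiv 3 \pmod 4$. (Note that $-2b \equiv 2 \equiv \pm(\delta_1+\delta_2) \pmod 4$, which implies $-2b \pm (\delta_1+\delta_2) \equiv 0 \pmod 4$.) (ii) If $b$ is even, $b = 2B$, and $B^2 - c$ is an odd integer, then all integer solutions are given by $$x = -B \pm (d_1 + d_2), \qquad y = \frac{d_1 - d_2}{2},$$ where $d_1, d_2$ can be any odd integers such that $d_1 d_2 = B^2 - c$ and $d_1 + d_2 > 0$. (iii) If $b$ is even, $b = 2B$, and $B^2 - c \equiv 2 \pmod 4$, then the equation has no integer solutions. (iv) If $b$ is even, $b = 2B$, and $B^2 - c \equiv 0 \pmod 4$, then all integer solutions are given by $$x = -B \pm 2(d_1 + d_2), \qquad y = d_1 - d_2,$$ where $d_1$ and $d_2$ can be any integers such that $d_1 d_2 = \frac{B^2 - c}{4}$ and $d_1 + d_2 \geq 0$. 2. If $b^2 - 4c = 0$, the equation has infinitely many solutions, given by $y =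 \pm\left(x + \frac{b}{2}\right)$.
   Context: A solution means a pair $(x,y)\in\mathbb{Z}\times\mathbb{Z}$ satisfying the equation $x^2+bx+c=y^2$, where $b$ and $c$ are fixed integers. In the even cases, $B$ denotes the integer $b/2$.
   Formalization: Corrected: in (ii), x = -B ± (d1+d2)/2 with d1+d2 ≥ 0 instead of x = -B ± (d1+d2) with d1+d2 > 0; in (iv), x = -B ± (d1+d2) instead of x = -B ± 2(d1+d2). The printed formulas fail, e.g. for b=0 and c=-1, c=1 (ii), c=-4 (iv). *)

theory Defs
  imports Complex_Main "HOL-Number_Theory.Cong"
begin

definition sols :: "int \<Rightarrow> int \<Rightarrow> (int \<times> int) set"
  where "sols b c = {(x, y). x^2 + b * x + c = y^2}"

text \<open>
  Solution formulas containing fractions are compared with the solution set inside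
  \<open>rat \<times> rat\<close>: then \<open>/\<close> is genuine division, and an equation between the two sets also
  says that every admissible parameter choice yields an integral point.
\<close>
definition rat_sols :: "int \<Rightarrow> int \<Rightarrow> (rat \<times> rat) set"
  where "rat_sols b c = map_prod of_int of_int ` sols b c"

text \<open>
  The published formulas for even \<open>b = 2 * B\<close> contain slips, corrected in the theorem.

  For \<open>B\<^sup>2 - c\<close> odd, the source prints \<open>x = -B \<plusminus> (d1 + d2)\<close> with \<open>d1 + d2 > 0\<close>; the theorem has
  \<open>x = -B \<plusminus> (d1 + d2) / 2\<close> with \<open>d1 + d2 \<ge> 0\<close>. For \<open>b = 0\<close>, \<open>c = -1\<close> the printed formula gives
  \<open>(2, 0)\<close> and \<open>(-2, 0)\<close>, while the solutions are \<open>(1, 0)\<close> and \<open>(-1, 0)\<close>; for \<open>b = 0\<close>, \<open>c = 1\<close>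
  the strict inequality would lose the solutions \<open>(0, 1)\<close> and \<open>(0, -1)\<close>.

  For \<open>B\<^sup>2 - c\<close> divisible by 4, the source prints \<open>x = -B \<plusminus> 2 * (d1 + d2)\<close>; the theorem has
  \<open>x = -B \<plusminus> (d1 + d2)\<close>. For \<open>b = 0\<close>, \<open>c = -4\<close> the printed formula gives \<open>(4, 0)\<close> and
  \<open>(-4, 0)\<close>, while the solutions are \<open>(2, 0)\<close> and \<open>(-2, 0)\<close>.
\<close>

end

theory Submission imports Defs begin

text \<open>
  Completing the square turns \<open>x\<^sup>2 + b * x + c = y\<^sup>2\<close> into
  \<open>(2 * x + b + 2 * y) * (2 * x + b - 2 * y) = b\<^sup>2 - 4 * c\<close>, so solutions correspond to
  factorizations \<open>e * f\<close> of the discriminant from which \<open>x\<close> and \<open>y\<close> can be recovered as integers;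
  that is a condition on \<open>e\<close> and \<open>f\<close> modulo 4. The reflection \<open>x \<mapsto> - b - x\<close> changes the sign of
  \<open>2 * x + b\<close>, so it is enough to consider factorizations with \<open>e + f \<ge> 0\<close> and to let a sign \<open>s\<close>
  choose between the two abscissae. This is the single parametrization
  \<open>rat_sols_eq_admissible\<close>. Each parity case of the theorem is that parametrization with the
  congruences worked out: for odd \<open>b\<close> the factors themselves are the parameters, and for even \<open>b\<close>
  both factors are even, so that one can divide them by 2, or by 4 when \<open>(b / 2)\<^sup>2 - c\<close> is
  divisible by 4, and gets a contradiction when that number is 2 modulo 4.

  For a nonzero discriminant there are finitely many solutions because both factors are divisors
  of it, and evenly many because \<open>(x, y) \<mapsto> (- b - x, - y)\<close> is an involution of the solution set;
  a fixed point would have \<open>2 * x + b = 0\<close> and \<open>y = 0\<close>, making the discriminant zero. For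
  discriminant zero the equation degenerates into two lines.
\<close>

section \<open>Solutions and factorizations of the discriminant\<close>

lemma sols_iff_square_diff:
  "(x, y) \<in> sols b c \<longleftrightarrow> (2 * x + b)^2 - (2 * y)^2 = b^2 - 4 * c"
proof -
  have "(2 * x + b)^2 - (2 * y)^2 - (b^2 - 4 * c) = 4 * (x^2 + b * x + c - y^2)"
    by (simp add: power2_eq_square algebra_simps)
  then show ?thesis
    by (auto simp: sols_def)
qed

lemma sols_iff_factorization:
  "(x, y) \<in> sols b c \<longleftrightarrow> (2 * x + b + 2 * y) * (2 * x + b - 2 * y) = b^2 - 4 * c"
  by (simp add: sols_iff_square_diff power2_eq_square algebra_simps)

text \<open>
  The congruences say that \<open>(e - f) / 4\<close> and \<open>(- 2 * b \<plusminus> (e + f)) / 4\<close> are integers. One sign in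
  the latter is enough: the first congruence makes \<open>e + f\<close> even, so the two values of
  \<open>- 2 * b \<plusminus> (e + f)\<close> differ by a multiple of 4.
\<close>
definition admissible_factors :: "int \<Rightarrow> int \<Rightarrow> (int \<times> int) set"
  where "admissible_factors b c =
    {(e, f). e * f = b^2 - 4 * c \<and> e + f \<ge> 0 \<and> 4 dvd e - f \<and> 4 dvd e + f + 2 * b}"

lemma int_pair_in_rat_sols_iff: "(of_int x, of_int y) \<in> rat_sols b c \<longleftrightarrow> (x, y) \<in> sols b c"
  by (auto simp: rat_sols_def map_prod_def)

lemma admissible_factors_gives_solution:
  fixes s :: rat
  assumes ef: "(e, f) \<in> admissible_factors b c" and s: "s \<in> {1, -1}"
  shows "((- 2 * of_int b + s * (of_int e + of_int f)) / 4, (of_int e - of_int f) / 4)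
    \<in> rat_sols b c"
proof -
  obtain t :: int where t: "s = of_int t" "t = 1 \<or> t = - 1"
    using s by (auto intro: that[of 1] that[of "- 1"])
  have prod: "e * f = b^2 - 4 * c" and d1: "4 dvd e - f" and d2: "4 dvd e + f + 2 * b"
    using ef by (auto simp: admissible_factors_def)
  obtain y where y: "e - f = 4 * y"
    using d1 by (auto elim: dvdE)
  have "4 dvd - 2 * b + t * (e + f)"
    using t(2) d1 d2 by presburger
  then obtain x where x: "- 2 * b + t * (e + f) = 4 * x"
    by (auto elim: dvdE)
  have "4 * (2 * x + b)^2 = (t * (e + f))^2"
  proof -
    have "t * (e + f) = 2 * (2 * x + b)"
      using x by simp
    then show ?thesis
      by (simp only: power_mult_distrib) simp
  qed
  also have "\<dots> = (e - f)^2 + 4 * (e * f)"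
    using t(2) by (auto simp: power2_eq_square algebra_simps)
  also have "\<dots> = 4 * ((2 * y)^2 + (b^2 - 4 * c))"
    unfolding prod y by (simp add: power2_eq_square)
  finally have "(x, y) \<in> sols b c"
    unfolding sols_iff_square_diff by simp
  moreover have "(- 2 * of_int b + s * (of_int e + of_int f)) / 4 = (of_int x :: rat)"
    using arg_cong[OF x, of "of_int :: int \<Rightarrow> rat"] by (simp add: t(1))
  moreover have "(of_int e - of_int f) / 4 = (of_int y :: rat)"
    using arg_cong[OF y, of "of_int :: int \<Rightarrow> rat"] by simp
  ultimately show ?thesis
    by (metis int_pair_in_rat_sols_iff)
qed

text \<open>
  The sign \<open>s\<close> is that of \<open>2 * x + b\<close>. If it is negative, the factors \<open>2 * x + b \<plusminus> 2 * y\<close> are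
  negated and swapped: this makes their sum nonnegative and keeps their product and difference.
\<close>
lemma solution_gives_admissible_factors:
  assumes "(x, y) \<in> sols b c"
  obtains s :: rat and e f where "s \<in> {1, -1}" "(e, f) \<in> admissible_factors b c"
    "of_int x = (- 2 * of_int b + s * (of_int e + of_int f)) / 4"
    "of_int y = (of_int e - of_int f :: rat) / 4"
proof -
  define t :: int where "t = (if 2 * x + b \<ge> 0 then 1 else - 1)"
  define e where "e = t * (2 * x + b) + 2 * y"
  define f where "f = t * (2 * x + b) - 2 * y"
  have t: "t = 1 \<or> t = - 1" "t * (2 * x + b) \<ge> 0"
    by (auto simp: t_def)
  have "e * f = (2 * x + b)^2 - (2 * y)^2"
    using t(1) by (auto simp: e_def f_def power2_eq_square algebra_simps)
  then have "e * f = b^2 - 4 * c"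
    using assms by (simp add: sols_iff_square_diff)
  moreover have "e + f \<ge> 0"
    using t(2) by (simp add: e_def f_def)
  moreover have "4 dvd e - f"
    by (simp add: e_def f_def)
  moreover have "4 dvd e + f + 2 * b"
    unfolding e_def f_def using t(1) by presburger
  ultimately have "(e, f) \<in> admissible_factors b c"
    by (simp add: admissible_factors_def)
  moreover have "of_int x = (- 2 * of_int b + of_int t * (of_int e + of_int f)) / (4 :: rat)"
    using t(1) by (auto simp: e_def f_def)
  moreover have "of_int y = (of_int e - of_int f :: rat) / 4"
    by (simp add: e_def f_def)
  moreover have "(of_int t :: rat) \<in> {1, -1}"
    using t(1) by auto
  ultimately show ?thesis
    using that by blast
qed

lemma rat_sols_eq_admissible:
  "rat_sols b c =
    {((- 2 * of_int b + s * (of_int e + of_int f)) / 4, (of_int e - of_int f) / 4) | s e f.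
       s \<in> {1, -1} \<and> (e, f) \<in> admissible_factors b c}" (is "_ = ?R")
proof (rule equalityI; rule subsetI)
  fix p assume "p \<in> rat_sols b c"
  then obtain x y where p: "p = (of_int x, of_int y)" and "(x, y) \<in> sols b c"
    by (auto simp: rat_sols_def)
  from this(2) show "p \<in> ?R"
    by (rule solution_gives_admissible_factors) (unfold p, blast)
next
  fix p assume "p \<in> ?R"
  then show "p \<in> rat_sols b c"
    using admissible_factors_gives_solution by blast
qed

section \<open>Finiteness and parity of the number of solutions\<close>

lemma finite_sols:
  assumes "b^2 - 4 * c \<noteq> 0"
  shows "finite (sols b c)"
proof -
  let ?D = "{d. d dvd b^2 - 4 * c}"
  let ?g = "\<lambda>(x, y). (2 * x + b + 2 * y, 2 * x + b - 2 * y)"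
  have "?g ` sols b c \<subseteq> ?D \<times> ?D"
    by (auto simp: sols_iff_factorization intro: dvdI[OF sym] dvdI[OF sym[OF trans[OF mult.commute]]])
  then have "finite (?g ` sols b c)"
    using finite_divisors_int[OF assms] by (meson finite_SigmaI finite_subset)
  moreover have "inj_on ?g (sols b c)"
    by (auto simp: inj_on_def)
  ultimately show ?thesis
    by (rule finite_imageD)
qed

text \<open>
  The involution \<open>(x, y) \<mapsto> (- b - x, - y)\<close> exchanges the two halves of the solution set that are
  cut out by the lexicographic sign of \<open>(2 * x + b, y)\<close>.
\<close>
lemma even_card_sols:
  assumes "b^2 - 4 * c \<noteq> 0"
  shows "even (card (sols b c))"
proof -
  let ?h = "\<lambda>(x, y). (- b - x, - y)"
  define P where "P = {(x, y) \<in> sols b c. 2 * x + b > 0 \<or> 2 * x + b = 0 \<and> y > 0}"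
  have h_sols: "(- b - x, - y) \<in> sols b c \<longleftrightarrow> (x, y) \<in> sols b c" for x y
    by (auto simp: sols_iff_factorization algebra_simps)
  have nonzero: "2 * x + b \<noteq> 0 \<or> y \<noteq> 0" if "(x, y) \<in> sols b c" for x y
    using that assms by (auto simp: sols_iff_square_diff)
  have "sols b c = P \<union> ?h ` P"
  proof (rule equalityI; rule subsetI)
    fix p assume p: "p \<in> sols b c"
    obtain x y where xy: "p = (x, y)"
      by (cases p)
    show "p \<in> P \<union> ?h ` P"
    proof (cases "p \<in> P")
      case False
      with p xy nonzero[of x y] have "(- b - x, - y) \<in> P"
        by (auto simp: P_def h_sols)
      then have "?h (- b - x, - y) \<in> ?h ` P"
        by (rule imageI)
      then show ?thesis
        by (simp add: xy)
    qed simp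
  qed (auto simp: P_def h_sols)
  moreover have "P \<inter> ?h ` P = {}"
    by (auto simp: P_def)
  moreover have "finite P"
    by (rule finite_subset[OF _ finite_sols[OF assms]]) (auto simp: P_def)
  moreover have "card (?h ` P) = card P"
    by (rule card_image) (auto simp: inj_on_def)
  ultimately show ?thesis
    by (simp add: card_Un_disjoint)
qed

section \<open>Admissible factorizations in each parity case\<close>

text \<open>
  Since \<open>4 dvd e - f\<close>, the remaining condition \<open>4 dvd e + f + 2 * b\<close> amounts to
  \<open>2 * e \<equiv> 2\<close> modulo 4, which holds exactly for odd \<open>e\<close>. The sum \<open>e + f\<close> is then 2 modulo 4,
  hence not zero.
\<close>
lemma admissible_factors_odd:
  assumes "odd b"
  shows "(e, f) \<in> admissible_factors b c \<longleftrightarrow>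
    e * f = b^2 - 4 * c \<and> e + f > 0 \<and>
    ([e = f] (mod 4) \<and> [f = 1] (mod 4) \<or> [e = f] (mod 4) \<and> [f = 3] (mod 4))"
proof -
  obtain k where "b = 2 * k + 1"
    using assms by (rule oddE)
  then have "4 dvd e + f + 2 * b \<longleftrightarrow> 4 dvd e + f + 2"
    by presburger
  moreover have "e + f \<ge> 0 \<longleftrightarrow> e + f > 0" if "4 dvd e + f + 2"
    using that by presburger
  moreover have "4 dvd e + f + 2 \<longleftrightarrow> 4 dvd f - 1 \<or> 4 dvd f - 3" if "4 dvd e - f"
    using that by presburger
  ultimately show ?thesis
    by (auto simp: admissible_factors_def cong_iff_dvd_diff)
qed

lemma admissible_factors_even:
  "(e, f) \<in> admissible_factors (2 * B) c \<longleftrightarrow>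
    (\<exists>d1 d2. e = 2 * d1 \<and> f = 2 * d2 \<and> d1 * d2 = B^2 - c \<and> d1 + d2 \<ge> 0 \<and> even (d1 - d2))"
proof
  assume ef: "(e, f) \<in> admissible_factors (2 * B) c"
  then have "even e" "even f"
    unfolding admissible_factors_def by (clarsimp, presburger)+
  then obtain d1 d2 where "e = 2 * d1" "f = 2 * d2"
    by (auto elim!: evenE)
  moreover from this ef have "d1 * d2 = B^2 - c \<and> d1 + d2 \<ge> 0 \<and> even (d1 - d2)"
    by (auto simp: admissible_factors_def power2_eq_square) presburger+
  ultimately show "\<exists>d1 d2. e = 2 * d1 \<and> f = 2 * d2 \<and> d1 * d2 = B^2 - c \<and> d1 + d2 \<ge> 0 \<and>
      even (d1 - d2)"
    by blast
next
  assume "\<exists>d1 d2. e = 2 * d1 \<and> f = 2 * d2 \<and> d1 * d2 = B^2 - c \<and> d1 + d2 \<ge> 0 \<and> even (d1 - d2)"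
  then obtain d1 d2 where d: "e = 2 * d1" "f = 2 * d2" "d1 * d2 = B^2 - c" "d1 + d2 \<ge> 0"
    "even (d1 - d2)"
    by blast
  then have "e * f = (2 * B)^2 - 4 * c"
    by (simp add: power2_eq_square)
  moreover have "4 dvd e - f" "4 dvd e + f + 2 * (2 * B)"
    using d by presburger+
  ultimately show "(e, f) \<in> admissible_factors (2 * B) c"
    using d(4) by (simp add: d(1,2) admissible_factors_def)
qed

text \<open>
  The factors \<open>e = 2 * d1\<close> and \<open>f = 2 * d2\<close> of the previous lemma give
  \<open>(- 4 * B + s * (e + f)) / 4 = - B + s * ((d1 + d2) / 2)\<close>.
\<close>
lemma rat_sols_even:
  "rat_sols (2 * B) c =
    {(- of_int B + s * ((of_int d1 + of_int d2) / 2), (of_int d1 - of_int d2) / 2) | s d1 d2.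
       s \<in> {1, -1} \<and> d1 * d2 = B^2 - c \<and> d1 + d2 \<ge> 0 \<and> even (d1 - d2)}"
proof -
  have point: "((- 2 * of_int (2 * B) + s * (of_int (2 * d1) + of_int (2 * d2))) / 4,
      (of_int (2 * d1) - of_int (2 * d2)) / 4)
    = (- of_int B + s * ((of_int d1 + of_int d2) / 2), (of_int d1 - of_int d2) / (2 :: rat))"
    for s :: rat and d1 d2
    by (simp add: field_simps)
  show ?thesis
    unfolding rat_sols_eq_admissible admissible_factors_even
    by (rule Collect_cong) (metis (no_types, opaque_lifting) point)
qed

lemma rat_sols_even_odd:
  assumes "odd (B^2 - c)"
  shows "rat_sols (2 * B) c =
    {(- of_int B + s * ((of_int d1 + of_int d2) / 2), (of_int d1 - of_int d2) / 2) | s d1 d2.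
       s \<in> {1, -1} \<and> odd d1 \<and> odd d2 \<and> d1 * d2 = B^2 - c \<and> d1 + d2 \<ge> 0}"
proof -
  have "d1 * d2 = B^2 - c \<and> d1 + d2 \<ge> 0 \<and> even (d1 - d2) \<longleftrightarrow>
      odd d1 \<and> odd d2 \<and> d1 * d2 = B^2 - c \<and> d1 + d2 \<ge> 0" for d1 d2
  proof -
    have "odd d1 \<and> odd d2" if "d1 * d2 = B^2 - c"
      using assms unfolding that[symmetric] by simp
    then show ?thesis
      by auto
  qed
  then show ?thesis
    unfolding rat_sols_even by simp
qed

text \<open>
  The parameters \<open>d1\<close> and \<open>d2\<close> of \<open>rat_sols_even\<close> have the same parity, so their product is never
  2 modulo 4, and if it is even, both can be divided by 2 once more.
\<close>
lemma same_parity_product_cases: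
  fixes d1 d2 :: int
  assumes "even (d1 - d2)"
  shows "even d1 \<and> even d2 \<and> 4 dvd d1 * d2 \<or> odd (d1 * d2)"
  using assms mult_dvd_mono[of 2 d1 2 d2] by auto

lemma sols_empty_of_cong_2:
  assumes "[B^2 - c = 2] (mod 4)"
  shows "sols (2 * B) c = {}"
proof -
  have "even n \<and> \<not> 4 dvd n" if "[n = 2] (mod 4)" for n :: int
    using that unfolding cong_iff_dvd_diff by presburger
  from this[OF assms] have "\<not> (d1 * d2 = B^2 - c \<and> even (d1 - d2))" for d1 d2
    using same_parity_product_cases[of d1 d2] by metis
  then have "rat_sols (2 * B) c = {}"
    unfolding rat_sols_even by auto
  then show ?thesis
    by (simp add: rat_sols_def)
qed

lemma rat_sols_even_div4:
  assumes "[B^2 - c = 0] (mod 4)"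
  shows "rat_sols (2 * B) c =
    {(- of_int B + s * (of_int d1 + of_int d2), of_int d1 - of_int d2) | s d1 d2.
       s \<in> {1, -1} \<and> of_int (d1 * d2) = (of_int (B^2 - c) / 4 :: rat) \<and> d1 + d2 \<ge> 0}"
proof -
  have pars: "k1 * k2 = B^2 - c \<and> k1 + k2 \<ge> 0 \<and> even (k1 - k2) \<longleftrightarrow>
      (\<exists>d1 d2. k1 = 2 * d1 \<and> k2 = 2 * d2 \<and>
        of_int (d1 * d2) = (of_int (B^2 - c) / 4 :: rat) \<and> d1 + d2 \<ge> 0)" for k1 k2
  proof -
    have quarter: "of_int (d1 * d2) = (of_int (B^2 - c) / 4 :: rat) \<longleftrightarrow>
        2 * d1 * (2 * d2) = B^2 - c" for d1 d2
    proof -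
      have "of_int (d1 * d2) = (of_int (B^2 - c) / 4 :: rat) \<longleftrightarrow>
          (of_int (2 * d1 * (2 * d2)) :: rat) = of_int (B^2 - c)"
        by (auto simp: field_simps)
      then show ?thesis
        by (simp only: of_int_eq_iff)
    qed
    have "even (B^2 - c)"
      using assms by (meson cong_0_iff dvd_trans even_numeral)
    then have "even k1 \<and> even k2" if "k1 * k2 = B^2 - c" "even (k1 - k2)"
      using same_parity_product_cases[of k1 k2] that by metis
    then show ?thesis
      unfolding quarter by (auto elim!: evenE)
  qed
  have point: "(- of_int B + s * ((of_int (2 * d1) + of_int (2 * d2)) / 2),
      (of_int (2 * d1) - of_int (2 * d2)) / 2)
    = (- of_int B + s * (of_int d1 + of_int d2), of_int d1 - of_int d2 :: rat)"
    for s :: rat and d1 d2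
    by (simp add: field_simps)
  show ?thesis
    unfolding rat_sols_even pars
    by (rule Collect_cong) (metis (no_types, opaque_lifting) point)
qed

section \<open>Discriminant zero\<close>

lemma discriminant_zero_even:
  fixes b c :: int
  assumes "b^2 - 4 * c = 0"
  obtains B where "b = 2 * B" "c = B^2"
proof -
  have "b^2 = 2 * (2 * c)"
    using assms by simp
  then have "even b"
    by (metis dvd_triv_left even_power)
  then obtain B where "b = 2 * B"
    by (auto elim: evenE)
  with assms show ?thesis
    using that by (simp add: power2_eq_square)
qed

lemma sols_discriminant_zero: "(x, y) \<in> sols (2 * B) (B^2) \<longleftrightarrow> y = x + B \<or> y = - (x + B)"
proof -
  have "x^2 + 2 * B * x + B^2 = (x + B)^2"
    by (simp add: power2_eq_square algebra_simps)
  then show ?thesis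
    unfolding sols_def using power2_eq_iff[of y "x + B"] by auto
qed

lemma infinite_sols_discriminant_zero: "infinite (sols (2 * B) (B^2))"
proof -
  have "inj (\<lambda>x. (x, x + B))"
    by (auto simp: inj_on_def)
  then have "infinite (range (\<lambda>x. (x, x + B)))"
    by (simp add: finite_image_iff infinite_UNIV_int)
  moreover have "range (\<lambda>x. (x, x + B)) \<subseteq> sols (2 * B) (B^2)"
    by (auto simp: sols_discriminant_zero)
  ultimately show ?thesis
    using finite_subset by blast
qed

lemma rat_sols_discriminant_zero:
  "rat_sols (2 * B) (B^2) =
    {(of_int x, s * (of_int x + of_int (2 * B) / 2)) | s x. s \<in> {1, -1}}" (is "_ = ?R")
proof (rule equalityI; rule subsetI)
  fix p assume "p \<in> rat_sols (2 * B) (B^2)"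
  then obtain x y where p: "p = (of_int x, of_int y)" and "y = x + B \<or> y = - (x + B)"
    by (auto simp: rat_sols_def sols_discriminant_zero)
  then obtain t :: int where "t = 1 \<or> t = - 1" and y: "y = t * (x + B)"
    by (metis mult_1 mult_minus1)
  then have "(of_int t :: rat) \<in> {1, - 1}"
    by auto
  moreover have "p = (of_int x, of_int t * (of_int x + of_int (2 * B) / 2))"
    by (simp add: p y)
  ultimately show "p \<in> ?R"
    by blast
next
  fix p assume "p \<in> ?R"
  then obtain s x where s: "s = 1 \<or> s = - 1"
    and p: "p = (of_int x, s * (of_int x + of_int (2 * B) / 2))"
    by blast
  from s have "p = (of_int x, of_int (x + B)) \<or> p = (of_int x, of_int (- (x + B)))"
    by (auto simp: p)
  then show "p \<in> rat_sols (2 * B) (B^2)"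
    by (auto simp only: int_pair_in_rat_sols_iff sols_discriminant_zero)
qed

section \<open>The solution formulas\<close>

lemma odd_case_congruences:
  fixes b s e f :: int
  assumes "odd b" "s \<in> {1, -1}"
    and "[e = f] (mod 4) \<and> [f = 1] (mod 4) \<or> [e = f] (mod 4) \<and> [f = 3] (mod 4)"
  shows "[- 2 * b = 2] (mod 4) \<and> [2 = s * (e + f)] (mod 4) \<and> [- 2 * b + s * (e + f) = 0] (mod 4)"
proof -
  from assms(2) consider "s = 1" | "s = - 1"
    by auto
  then show ?thesis
    using assms(1,3) unfolding cong_iff_dvd_diff by cases (hypsubst, presburger)+
qed

theorem theorem1:
  fixes b c :: int
  shows
   "(b^2 - 4 * c \<noteq> 0 \<longrightarrow>
       finite (sols b c) \<and> even (card (sols b c)) \<and>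
       (odd b \<longrightarrow>
          rat_sols b c =
            {((- 2 * of_int b + s * (of_int \<delta>1 + of_int \<delta>2)) / 4, (of_int \<delta>1 - of_int \<delta>2) / 4) | s \<delta>1 \<delta>2.
               s \<in> {1, -1} \<and> \<delta>1 * \<delta>2 = b^2 - 4 * c \<and> \<delta>1 + \<delta>2 > 0 \<and>
               ([\<delta>1 = \<delta>2] (mod 4) \<and> [\<delta>2 = 1] (mod 4) \<or> [\<delta>1 = \<delta>2] (mod 4) \<and> [\<delta>2 = 3] (mod 4))} \<and>
          (\<forall>s \<delta>1 \<delta>2 :: int.
               s \<in> {1, -1} \<and> \<delta>1 * \<delta>2 = b^2 - 4 * c \<and> \<delta>1 + \<delta>2 > 0 \<and>
               ([\<delta>1 = \<delta>2] (mod 4) \<and> [\<delta>2 = 1] (mod 4) \<or> [\<delta>1 = \<delta>2] (mod 4) \<and> [\<delta>2 = 3] (mod 4)) \<longrightarrow>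
               [- 2 * b = 2] (mod 4) \<and> [2 = s * (\<delta>1 + \<delta>2)] (mod 4) \<and>
               [- 2 * b + s * (\<delta>1 + \<delta>2) = 0] (mod 4))) \<and>
       (\<forall>B. b = 2 * B \<and> odd (B^2 - c) \<longrightarrow>
          rat_sols b c =
            {(- of_int B + s * ((of_int d1 + of_int d2) / 2), (of_int d1 - of_int d2) / 2) | s d1 d2.
               s \<in> {1, -1} \<and> odd d1 \<and> odd d2 \<and> d1 * d2 = B^2 - c \<and> d1 + d2 \<ge> 0}) \<and>
       (\<forall>B. b = 2 * B \<and> [B^2 - c = 2] (mod 4) \<longrightarrow> sols b c = {}) \<and>
       (\<forall>B. b = 2 * B \<and> [B^2 - c = 0] (mod 4) \<longrightarrow>
          rat_sols b c =
            {(- of_int B + s * (of_int d1 + of_int d2), of_int d1 - of_int d2) | s d1 d2.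
               s \<in> {1, -1} \<and> of_int (d1 * d2) = (of_int (B^2 - c) / 4 :: rat) \<and> d1 + d2 \<ge> 0})) \<and>
    (b^2 - 4 * c = 0 \<longrightarrow>
       infinite (sols b c) \<and>
       rat_sols b c = {(of_int x, s * (of_int x + of_int b / 2)) | s x. s \<in> {1, -1}})"
proof (intro conjI impI allI)
  assume nz: "b^2 - 4 * c \<noteq> 0"
  show "finite (sols b c)" "even (card (sols b c))"
    using nz by (rule finite_sols, rule even_card_sols)
next
  assume "odd b"
  show "rat_sols b c =
    {((- 2 * of_int b + s * (of_int \<delta>1 + of_int \<delta>2)) / 4, (of_int \<delta>1 - of_int \<delta>2) / 4) | s \<delta>1 \<delta>2.
       s \<in> {1, -1} \<and> \<delta>1 * \<delta>2 = b^2 - 4 * c \<and> \<delta>1 + \<delta>2 > 0 \<and>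
       ([\<delta>1 = \<delta>2] (mod 4) \<and> [\<delta>2 = 1] (mod 4) \<or> [\<delta>1 = \<delta>2] (mod 4) \<and> [\<delta>2 = 3] (mod 4))}"
    unfolding rat_sols_eq_admissible admissible_factors_odd[OF \<open>odd b\<close>] ..
next
  assume "odd b"
  then show "[- 2 * b = 2] (mod 4)" "[2 = s * (\<delta>1 + \<delta>2)] (mod 4)"
    "[- 2 * b + s * (\<delta>1 + \<delta>2) = 0] (mod 4)"
    if "s \<in> {1, -1} \<and> \<delta>1 * \<delta>2 = b^2 - 4 * c \<and> \<delta>1 + \<delta>2 > 0 \<and>
      ([\<delta>1 = \<delta>2] (mod 4) \<and> [\<delta>2 = 1] (mod 4) \<or> [\<delta>1 = \<delta>2] (mod 4) \<and> [\<delta>2 = 3] (mod 4))"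
    for s \<delta>1 \<delta>2
    using odd_case_congruences[of b s \<delta>1 \<delta>2] that by blast+
next
  assume "b^2 - 4 * c = 0"
  then obtain B where "b = 2 * B" "c = B^2"
    by (rule discriminant_zero_even)
  then show "infinite (sols b c)"
    "rat_sols b c = {(of_int x, s * (of_int x + of_int b / 2)) | s x. s \<in> {1, -1}}"
    by (simp_all only: infinite_sols_discriminant_zero rat_sols_discriminant_zero not_False_eq_True)
  \<comment> \<open>The goals left are the three cases of even \<open>b\<close>.\<close>
qed (elim conjE, hypsubst,
  (rule rat_sols_even_odd sols_empty_of_cong_2 rat_sols_even_div4; assumption))+

end
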